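(* For all positive integers $n$ and $k$ there exists a positive integer $N=N(n,k)$ such that the following holds. Let $U$ be a set of $k$ direction vectors in the plane, and let $\mathcal{J}_U$ be the set of all line segments in direction $u$ for some $u\in U$. Then $f_{\mathcal{J}_U}(n)\le N$.
   Context: For a direction vector $u$ in $\mathbb{R}^2$ and $v\in\mathbb{R}^2$, the set $\{ut+v:t\in\mathbb{R}\}$ is a line in direction $u$. A simple curve is an injective continuous map from an interval to $\mathbb{R}^2$; a line segment is a simple curve whose image lies on a line, and it is in direction $u$ if it is contained in a line in direction $u$ (segments are identified with their images as subsets of the plane). Given families $\mathcal{F}_1,\dots,\mathcal{F}_m$ of nonempty sets, a system of disjoint representatives (SDR) of size $n$ is a set $\{A_1,\dots,A_n\}$ of mutually disjoint sets in $\bigcup_{i\in[m]}\mathcal{F}_i$ such that there are distinct $p_1,\dots,p_n\in[m]$ with $A_j\in\mathcal{F}_{p_j}$ for all $j\in[n]$. For a family $\mathcal{F}$ of sets and a positive integer $n$, $f_{\mathcal{F}}(n)$ is the minimum integer $k\ge n$ such that for every $k$ subfamilies of $\mathcal{F}$ (not necessarily distinct), each consisting of $n$ mutually disjoint members of $\mathcal{F}$, there is an SDR of size $n$ (and $f_{\mathcal{F}}(n)=\infty$ if no such $k$ exists). *)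

theory Defs
  imports "HOL-Analysis.Analysis"
begin

definition line_in_direction :: "real^2 \<Rightarrow> real^2 \<Rightarrow> (real^2) set" where
  "line_in_direction u v = {t *\<^sub>R u + v | t. t \<in> (UNIV :: real set)}"

definition direction_vector :: "real^2 \<Rightarrow> bool" where
  "direction_vector u \<longleftrightarrow> u \<noteq> 0"

(* Curves are identified with their images. The parameter interval is an arbitrary nonempty
   interval: it may be open, half-open, unbounded, or a single point. *)

definition simple_curve :: "(real^2) set \<Rightarrow> bool" where
  "simple_curve S \<longleftrightarrow>
     (\<exists>(I :: real set) \<gamma>. is_interval I \<and> I \<noteq> {} \<and> continuous_on I \<gamma> \<and> inj_on \<gamma> I \<and> S = \<gamma> ` I)"

definition line_segment :: "(real^2) set \<Rightarrow> bool" where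
  "line_segment S \<longleftrightarrow>
     simple_curve S \<and> (\<exists>u v. direction_vector u \<and> S \<subseteq> line_in_direction u v)"

definition in_direction :: "(real^2) set \<Rightarrow> real^2 \<Rightarrow> bool" where
  "in_direction S u \<longleftrightarrow> (\<exists>v. S \<subseteq> line_in_direction u v)"

definition segments_in_directions :: "(real^2) set \<Rightarrow> (real^2) set set" where
  "segments_in_directions U = {S. line_segment S \<and> (\<exists>u\<in>U. in_direction S u)}"

(* The families are F 1, ..., F m; the injective choice p of indices is made on the members
   of R themselves. *)

definition is_SDR :: "nat \<Rightarrow> (nat \<Rightarrow> 'a set set) \<Rightarrow> nat \<Rightarrow> 'a set set \<Rightarrow> bool" where
  "is_SDR m F n R \<longleftrightarrow>
     finite R \<and> card R = n \<and> pairwise disjnt R \<and> R \<subseteq> (\<Union>i\<in>{1..m}. F i) \<and>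
     (\<exists>p. inj_on p R \<and> (\<forall>A\<in>R. p A \<in> {1..m} \<and> A \<in> F (p A)))"

definition disjoint_subfamily :: "'a set set \<Rightarrow> nat \<Rightarrow> 'a set set \<Rightarrow> bool" where
  "disjoint_subfamily \<F> n G \<longleftrightarrow> G \<subseteq> \<F> \<and> finite G \<and> card G = n \<and> pairwise disjnt G"

(* The infimum over the empty set is \<infinity>; over a nonempty set it is the minimum. *)

definition sdr_number :: "'a set set \<Rightarrow> nat \<Rightarrow> enat" where
  "sdr_number \<F> n =
     Inf {enat k | k. k \<ge> n \<and>
       (\<forall>F. (\<forall>i\<in>{1..k}. disjoint_subfamily \<F> n (F i)) \<longrightarrow> (\<exists>R. is_SDR k F n R))}"

end

theory Submission
  imports Defs "HOL-Library.Ramsey"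
begin

text \<open>List the members of every family as n columns. By Ramsey's theorem there are many
  families in which the direction of the member in a given column, and the pairs of columns
  whose members meet, do not depend on the families chosen. If the members in some column are
  mutually disjoint, n of them form an SDR. Otherwise any two members in the same column meet
  and are parallel, so every column lies on a single line. Members of different families in
  columns on different lines are disjoint: otherwise, given three families, the crossing point
  of the two lines would belong to two members of the middle one. For the columns on one line,
  choose among all their members one that ends first. It meets at most one member of any other
  family, hence only those in its own column, so its family and its column can be removed and
  the argument repeated.\<close>

section \<open>Ramsey's theorem for pairs\<close>

text \<open>\<open>N\<close> is fixed before \<open>C\<close>: in the theorem the colours are built
  from \<open>U\<close>, while the bound may depend only on the size of \<open>U\<close>. The
  condition \<open>N \<ge> n\<close> serves the same condition in \<open>sdr_number\<close>.\<close>

lemma ramsey_pairs: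
  fixes n M K :: nat
  shows "\<exists>N\<ge>n. \<forall>(C :: 'c set) g. finite C \<and> card C = K \<and> (\<forall>i j. i < j \<and> j < N \<longrightarrow> g i j \<in> C) \<longrightarrow>
    (\<exists>H\<subseteq>{..<N}. card H = M \<and> (\<exists>c. \<forall>i\<in>H. \<forall>j\<in>H. i < j \<longrightarrow> g i j = c))"
proof -
  obtain N0 :: nat where "partn_lst {..<N0} (replicate K M) 2"
    using ramsey_full by blast
  then have N: "partn_lst {..<max N0 n} (replicate K M) 2"
    by (rule partn_lst_greater_resource) simp
  let ?N = "max N0 n"
  have homogeneous: "\<exists>H\<subseteq>{..<?N}. card H = M \<and> (\<exists>c. \<forall>i\<in>H. \<forall>j\<in>H. i < j \<longrightarrow> g i j = c)"
    if C: "finite C" "card C = K" and g: "\<And>i j. i < j \<Longrightarrow> j < ?N \<Longrightarrow> g i j \<in> C"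
    for C :: "'c set" and g
  proof -
    obtain h where h: "bij_betw h C {..<K}"
      using C ex_bij_betw_finite_nat[of C] by (auto simp: atLeast0LessThan)
    \<comment> \<open>\<open>g\<close> need not be symmetric: \<open>Min\<close> and
      \<open>Max\<close> recover the ordered pair from a two-element set, and \<open>h\<close>
      numbers the colours.\<close>
    define f where "f X = h (g (Min X) (Max X))" for X
    have f2: "f {i, j} = h (g i j)" if "i < j" for i j
      using that by (simp add: f_def min_def max_def)
    have "f X \<in> {..<K}" if X: "X \<in> nsets {..<?N} 2" for X
    proof -
      obtain i j where "X = {i, j}" "i < j" "j < ?N"
        using X by (auto simp: ordered_nsets_2_eq)
      then show ?thesis
        using f2 g h by (auto simp: bij_betw_def)
    qed
    then have "f \<in> nsets {..<?N} 2 \<rightarrow> {..<length (replicate K M)}"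
      by simp
    with N obtain c H where c: "c < K" and H: "H \<in> nsets {..<?N} M"
      and mono: "f ` nsets H 2 \<subseteq> {c}"
      unfolding partn_lst_def monochromatic_def by (metis length_replicate nth_replicate)
    have "g i j = inv_into C h c" if "i \<in> H" "j \<in> H" "i < j" for i j
    proof -
      have "{i, j} \<in> nsets H 2"
        using that by simp
      then have "h (g i j) = c"
        using mono f2[OF \<open>i < j\<close>] by (metis image_subset_iff singletonD)
      moreover have "g i j \<in> C"
        using g H that by (auto simp: nsets_def)
      ultimately show ?thesis
        using h by (metis bij_betw_imp_inj_on inv_into_f_f)
    qed
    then show ?thesis
      using H unfolding nsets_def by blast
  qed
  show ?thesis
  proof (intro exI[of _ ?N] conjI allI impI)
    fix C :: "'c set" and g
    assume "finite C \<and> card C = K \<and> (\<forall>i j. i < j \<and> j < ?N \<longrightarrow> g i j \<in> C)"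
    then show "\<exists>H\<subseteq>{..<?N}. card H = M \<and> (\<exists>c. \<forall>i\<in>H. \<forall>j\<in>H. i < j \<longrightarrow> g i j = c)"
      by (intro homogeneous[of C g]) simp_all
  qed simp
qed

section \<open>Lines and segments in the plane\<close>

lemma line_in_direction_through:
  assumes "x \<in> line_in_direction u v"
  shows "line_in_direction u v = line_in_direction u x"
proof -
  obtain s where x: "x = s *\<^sub>R u + v"
    using assms by (auto simp: line_in_direction_def)
  have "t *\<^sub>R u + v = (t - s) *\<^sub>R u + x" "t *\<^sub>R u + x = (t + s) *\<^sub>R u + v" for t
    by (simp_all add: x algebra_simps)
  then show ?thesis
    unfolding line_in_direction_def by blast
qed

lemma line_in_direction_scaleR:
  assumes "c \<noteq> 0"
  shows "line_in_direction (c *\<^sub>R u) v = line_in_direction u v"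
proof -
  have "t *\<^sub>R u + v = (t / c) *\<^sub>R (c *\<^sub>R u) + v" for t
    using assms by simp
  moreover have "t *\<^sub>R (c *\<^sub>R u) + v = (t * c) *\<^sub>R u + v" for t
    by simp
  ultimately show ?thesis
    unfolding line_in_direction_def by blast
qed

text \<open>The right-hand side depends only on the two points, so two different lines share at most
  one point.\<close>

lemma line_in_direction_two_points:
  assumes "x \<in> line_in_direction u v" "y \<in> line_in_direction u v" "x \<noteq> y"
  shows "line_in_direction u v = line_in_direction (y - x) x"
proof -
  obtain s t where st: "x = s *\<^sub>R u + v" "y = t *\<^sub>R u + v"
    using assms by (auto simp: line_in_direction_def)
  then have "y - x = (t - s) *\<^sub>R u" "t - s \<noteq> 0"
    using assms(3) by (auto simp: algebra_simps)
  then show ?thesis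
    using line_in_direction_scaleR line_in_direction_through[OF assms(1)] by simp
qed

text \<open>Along the line, \<open>x \<bullet> u\<close> is affine in the parameter with slope
  \<open>u \<bullet> u\<close>, so it is a coordinate that turns connected subsets of the line into
  real intervals.\<close>

lemma inj_on_inner_line_in_direction:
  assumes "u \<noteq> 0"
  shows "inj_on (\<lambda>x. x \<bullet> u) (line_in_direction u v)"
proof (rule inj_onI)
  fix x y assume "x \<in> line_in_direction u v" "y \<in> line_in_direction u v" and eq: "x \<bullet> u = y \<bullet> u"
  then obtain s t where "x = s *\<^sub>R u + v" "y = t *\<^sub>R u + v"
    by (auto simp: line_in_direction_def)
  then show "x = y"
    using eq assms by (simp add: inner_add_left)
qed

lemma segments_in_directionsD:
  assumes "S \<in> segments_in_directions U"
  shows "connected S" "S \<noteq> {}" "\<exists>u\<in>U. in_direction S u"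
proof -
  show "\<exists>u\<in>U. in_direction S u"
    using assms by (auto simp: segments_in_directions_def)
  obtain I :: "real set" and \<gamma> where "is_interval I" "I \<noteq> {}" "continuous_on I \<gamma>" "S = \<gamma> ` I"
    using assms by (auto simp: segments_in_directions_def line_segment_def simple_curve_def)
  then show "connected S" "S \<noteq> {}"
    by (auto simp: is_interval_connected_1 connected_continuous_image)
qed

section \<open>Comparing right ends of intervals\<close>

text \<open>The condition on A and B compares the right ends of A and B, and is meaningful also for
  unbounded sets and for ends that are not attained.\<close>

lemma ex_first_ending:
  fixes T :: "'i \<Rightarrow> real set"
  assumes "finite X" "X \<noteq> {}"
  shows "\<exists>x\<in>X. \<forall>y\<in>X. \<forall>a\<in>T x. \<exists>b\<in>T y. a \<le> b"
  using assms
proof (induction rule: finite_ne_induct)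
  case (singleton x)
  then show ?case by auto
next
  case (insert z X)
  then obtain x where x: "x \<in> X" "\<forall>y\<in>X. \<forall>a\<in>T x. \<exists>b\<in>T y. a \<le> b"
    by blast
  show ?case
  proof (cases "\<forall>a\<in>T x. \<exists>b\<in>T z. a \<le> b")
    case True
    then show ?thesis using x by blast
  next
    case False
    \<comment> \<open>Some \<open>a\<close> in \<open>T x\<close> is an upper bound of
      \<open>T z\<close>. Every \<open>T y\<close> reaches at least to \<open>a\<close>, so
      \<open>z\<close> ends first.\<close>
    then obtain a where a: "a \<in> T x" "\<forall>b\<in>T z. b \<le> a"
      by (meson linear)
    then have "\<forall>y\<in>X. \<forall>b\<in>T z. \<exists>d\<in>T y. b \<le> d"
      using x by (meson order_trans)
    then show ?thesis by blast
  qed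
qed

text \<open>Take a point of \<open>A\<close> in \<open>B\<close> and one in \<open>B'\<close>. The
  interval with the smaller point reaches at least to the larger one, since \<open>A\<close> ends
  first, and therefore contains it.\<close>

lemma first_ending_meets_two:
  fixes A B B' :: "real set"
  assumes "is_interval B" "is_interval B'"
    and "\<forall>a\<in>A. \<exists>b\<in>B. a \<le> b" "\<forall>a\<in>A. \<exists>b\<in>B'. a \<le> b"
    and "A \<inter> B \<noteq> {}" "A \<inter> B' \<noteq> {}"
  shows "B \<inter> B' \<noteq> {}"
proof -
  have *: "y \<in> D" if "is_interval D" "\<forall>a\<in>A. \<exists>b\<in>D. a \<le> b" "x \<in> D" "y \<in> A" "x \<le> y"
    for D :: "real set" and x y
    using that by (meson mem_is_interval_1_I)
  obtain x y where "x \<in> A" "x \<in> B" "y \<in> A" "y \<in> B'"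
    using assms by blast
  then show ?thesis
    using *[of B x y] *[of B' y x] assms(1-4) linear[of x y] by auto
qed

section \<open>Greedy choice of one row for each column\<close>

text \<open>Rows \<open>i\<close> stand for families and columns \<open>p\<close> for positions in
  them. The hypothesis \<open>peel\<close> passes to subsets, so the row and the column it yields
  can be deleted and the induction continues on \<open>card S\<close>.\<close>

lemma disjoint_choice_by_peeling:
  fixes a :: "'i \<Rightarrow> 'p \<Rightarrow> 'a set"
  assumes "finite S" "finite I" "card S \<le> card I"
    and peel: "\<And>S' I'. S' \<subseteq> S \<Longrightarrow> I' \<subseteq> I \<Longrightarrow> S' \<noteq> {} \<Longrightarrow> I' \<noteq> {} \<Longrightarrow>
      \<exists>i\<in>I'. \<exists>p\<in>S'. \<forall>j\<in>I' - {i}. \<forall>q\<in>S' - {p}. a i p \<inter> a j q = {}"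
  shows "\<exists>\<sigma>. inj_on \<sigma> S \<and> \<sigma> ` S \<subseteq> I \<and>
    (\<forall>p\<in>S. \<forall>q\<in>S. p \<noteq> q \<longrightarrow> a (\<sigma> p) p \<inter> a (\<sigma> q) q = {})"
  using assms
proof (induction "card S" arbitrary: S I)
  case 0
  then show ?case by simp
next
  case (Suc m)
  then have "S \<noteq> {}" "I \<noteq> {}"
    by auto
  then obtain i p where ip: "i \<in> I" "p \<in> S"
    and disj: "\<forall>j\<in>I - {i}. \<forall>q\<in>S - {p}. a i p \<inter> a j q = {}"
    using Suc.prems(4)[of S I] by blast
  have "\<exists>\<sigma>. inj_on \<sigma> (S - {p}) \<and> \<sigma> ` (S - {p}) \<subseteq> I - {i} \<and>
    (\<forall>q\<in>S - {p}. \<forall>r\<in>S - {p}. q \<noteq> r \<longrightarrow> a (\<sigma> q) q \<inter> a (\<sigma> r) r = {})"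
  proof (rule Suc.hyps(1))
    show "m = card (S - {p})" "card (S - {p}) \<le> card (I - {i})"
      using Suc.hyps(2) Suc.prems ip by (auto simp: card_Diff_singleton)
    fix S' I' assume "S' \<subseteq> S - {p}" "I' \<subseteq> I - {i}" "S' \<noteq> {}" "I' \<noteq> {}"
    then show "\<exists>i\<in>I'. \<exists>p\<in>S'. \<forall>j\<in>I' - {i}. \<forall>q\<in>S' - {p}. a i p \<inter> a j q = {}"
      using Suc.prems(4)[of S' I'] by blast
  qed (use Suc.prems in auto)
  then obtain \<sigma> where \<sigma>: "inj_on \<sigma> (S - {p})" "\<sigma> ` (S - {p}) \<subseteq> I - {i}"
    "\<forall>q\<in>S - {p}. \<forall>r\<in>S - {p}. q \<noteq> r \<longrightarrow> a (\<sigma> q) q \<inter> a (\<sigma> r) r = {}"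
    by (elim exE conjE)
  \<comment> \<open>The old \<sigma> avoids \<open>i\<close>, which gives both injectivity and,
    through \<open>disj\<close>, disjointness of the new representative from the others.\<close>
  have "inj_on (\<sigma>(p := i)) S"
    using \<sigma>(1,2) by (auto simp: inj_on_def)
  moreover have "(\<sigma>(p := i)) ` S \<subseteq> I"
    using \<sigma>(2) ip by auto
  moreover have "a ((\<sigma>(p := i)) q) q \<inter> a ((\<sigma>(p := i)) r) r = {}"
    if "q \<in> S" "r \<in> S" "q \<noteq> r" for q r
  proof -
    have "a i p \<inter> a (\<sigma> s) s = {}" if "s \<in> S" "s \<noteq> p" for s
      using that disj \<sigma>(2) by blast
    then show ?thesis
      using that \<sigma>(3) by (auto simp: Int_commute)
  qed
  ultimately show ?case by blast
qed

text \<open>A member ending first on its line can be peeled off: if \<open>a i p\<close> met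
  \<open>a j q\<close> on the same line, it would meet both \<open>a j p\<close> (by
  \<open>col\<close>) and \<open>a j q\<close>, forcing these two to meet, against
  \<open>row\<close>.\<close>

lemma disjoint_choice_collinear_columns:
  fixes a :: "'i \<Rightarrow> 'p \<Rightarrow> (real^2) set" and u v :: "'p \<Rightarrow> real^2"
  assumes fin: "finite S" "finite I" "card S \<le> card I"
    and conn: "\<And>i p. i \<in> I \<Longrightarrow> p \<in> S \<Longrightarrow> connected (a i p)"
    and line: "\<And>i p. i \<in> I \<Longrightarrow> p \<in> S \<Longrightarrow> a i p \<subseteq> line_in_direction (u p) (v p)"
    and u: "\<And>p. p \<in> S \<Longrightarrow> u p \<noteq> 0"
    and row: "\<And>i p q. i \<in> I \<Longrightarrow> p \<in> S \<Longrightarrow> q \<in> S \<Longrightarrow> p \<noteq> q \<Longrightarrow> a i p \<inter> a i q = {}"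
    and col: "\<And>i j p. i \<in> I \<Longrightarrow> j \<in> I \<Longrightarrow> i \<noteq> j \<Longrightarrow> p \<in> S \<Longrightarrow> a i p \<inter> a j p \<noteq> {}"
    and cross: "\<And>i j p q. i \<in> I \<Longrightarrow> j \<in> I \<Longrightarrow> i \<noteq> j \<Longrightarrow> p \<in> S \<Longrightarrow> q \<in> S \<Longrightarrow>
      line_in_direction (u p) (v p) \<noteq> line_in_direction (u q) (v q) \<Longrightarrow> a i p \<inter> a j q = {}"
  shows "\<exists>\<sigma>. inj_on \<sigma> S \<and> \<sigma> ` S \<subseteq> I \<and>
    (\<forall>p\<in>S. \<forall>q\<in>S. p \<noteq> q \<longrightarrow> a (\<sigma> p) p \<inter> a (\<sigma> q) q = {})"
proof (rule disjoint_choice_by_peeling[OF fin])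
  fix S' I' assume S': "S' \<subseteq> S" "S' \<noteq> {}" and I': "I' \<subseteq> I" "I' \<noteq> {}"
  then obtain p0 where p0: "p0 \<in> S'" by blast
  define L where "L = line_in_direction (u p0) (v p0)"
  \<comment> \<open>\<open>Q\<close> collects the remaining columns on the line \<open>L\<close> of
    \<open>p0\<close>; \<open>T\<close> holds the coordinates along \<open>L\<close> of the members,
    indexed by row and column.\<close>
  define Q where "Q = {p \<in> S'. line_in_direction (u p) (v p) = L}"
  define h where "h x = x \<bullet> u p0" for x
  define T where "T = (\<lambda>(i, p). h ` a i p)"
  have sub: "a i p \<subseteq> L" if "i \<in> I'" "p \<in> Q" for i p
    using that line S' I' unfolding Q_def by blast
  have "inj_on h L"
    unfolding L_def h_def using u p0 S' by (intro inj_on_inner_line_in_direction) blast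
  then have h_Int: "h ` A \<inter> h ` B = h ` (A \<inter> B)" if "A \<subseteq> L" "B \<subseteq> L" for A B
    using inj_on_image_Int that by metis
  have ivl: "is_interval (T (i, p))" if "i \<in> I'" "p \<in> Q" for i p
  proof -
    have "connected (a i p)"
      using conn that S' I' by (auto simp: Q_def)
    then show ?thesis
      unfolding T_def h_def
      by (auto simp: is_interval_connected_1 intro!: connected_continuous_image continuous_intros)
  qed
  have "finite S'" "finite I'"
    using fin S' I' finite_subset by auto
  then have "finite (I' \<times> Q)" "I' \<times> Q \<noteq> {}"
    using I' p0 unfolding Q_def L_def by auto
  then obtain z where "z \<in> I' \<times> Q" "\<forall>y\<in>I' \<times> Q. \<forall>s\<in>T z. \<exists>t\<in>T y. s \<le> t"
    using ex_first_ending[of "I' \<times> Q" T] by metis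
  then obtain i p where ip: "i \<in> I'" "p \<in> Q"
    and first: "\<And>j q. j \<in> I' \<Longrightarrow> q \<in> Q \<Longrightarrow> \<forall>s\<in>T (i, p). \<exists>t\<in>T (j, q). s \<le> t"
    by (metis mem_Sigma_iff surj_pair)
  have "a i p \<inter> a j q = {}" if j: "j \<in> I' - {i}" and q: "q \<in> S' - {p}" for j q
  proof (cases "q \<in> Q")
    case False
    \<comment> \<open>A column outside \<open>Q\<close> lies on a line other than
      \<open>L\<close>.\<close>
    then show ?thesis
      using cross[of i j p q] ip j q S' I' by (auto simp: Q_def)
  next
    case True
    show ?thesis
    proof (rule ccontr)
      assume meets: "a i p \<inter> a j q \<noteq> {}"
      have "a i p \<inter> a j p \<noteq> {}"
        using col[of i j p] ip j S' I' by (auto simp: Q_def)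
      then have "T (i, p) \<inter> T (j, p) \<noteq> {}" "T (i, p) \<inter> T (j, q) \<noteq> {}"
        using meets by (auto simp: T_def)
      then have "T (j, p) \<inter> T (j, q) \<noteq> {}"
        using first_ending_meets_two[of "T (j, p)" "T (j, q)" "T (i, p)"] ivl first ip j True
        by blast
      moreover have "T (j, p) \<inter> T (j, q) = h ` (a j p \<inter> a j q)"
        using h_Int[OF sub sub] ip j True by (simp add: T_def)
      moreover have "a j p \<inter> a j q = {}"
        using row[of j p q] ip j q S' I' by (auto simp: Q_def)
      ultimately show False by simp
    qed
  qed
  then show "\<exists>i\<in>I'. \<exists>p\<in>S'. \<forall>j\<in>I' - {i}. \<forall>q\<in>S' - {p}. a i p \<inter> a j q = {}"
    using ip unfolding Q_def by blast
qed

section \<open>From a disjoint choice to an SDR\<close>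

text \<open>Disjoint nonempty sets are distinct, so \<open>b\<close> is injective and the index map
  \<open>r\<close> can be transported to the sets themselves, as \<open>is_SDR\<close>
  requires.\<close>

lemma is_SDR_image:
  assumes "finite T" "card T = n" "inj_on r T" "r ` T \<subseteq> {1..m}"
    and mem: "\<And>t. t \<in> T \<Longrightarrow> b t \<in> F (r t)"
    and ne: "\<And>t. t \<in> T \<Longrightarrow> b t \<noteq> {}"
    and disj: "\<And>s t. s \<in> T \<Longrightarrow> t \<in> T \<Longrightarrow> s \<noteq> t \<Longrightarrow> b s \<inter> b t = {}"
  shows "is_SDR m F n (b ` T)"
proof -
  have inj: "inj_on b T"
    using ne disj by (intro inj_onI) (metis Int_absorb)
  define p where "p A = r (inv_into T b A)" for A
  have p: "p (b t) = r t" if "t \<in> T" for t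
    using inj that by (simp add: p_def)
  have "inj_on p (b ` T)"
    using assms(3) p by (auto simp: inj_on_def)
  moreover have "pairwise disjnt (b ` T)"
    using disj by (auto simp: pairwise_def disjnt_def)
  moreover have "\<forall>A\<in>b ` T. p A \<in> {1..m} \<and> A \<in> F (p A)"
    using p mem assms(4) by auto
  moreover from this have "b ` T \<subseteq> (\<Union>i\<in>{1..m}. F i)"
    by blast
  ultimately show ?thesis
    using assms(1,2) inj unfolding is_SDR_def by (auto simp: card_image)
qed

section \<open>The bound for \<open>k\<close> directions\<close>

theorem theorem1p1:
  fixes n k :: nat
  assumes "n \<ge> 1" and "k \<ge> 1"
  shows "\<exists>N::nat. N \<ge> 1 \<and>
    (\<forall>U :: (real^2) set. finite U \<and> card U = k \<and> (\<forall>u\<in>U. direction_vector u) \<longrightarrow>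
       sdr_number (segments_in_directions U) n \<le> enat N)"
proof -
  \<comment> \<open>Number of colours: \<open>k ^ n\<close> ways to give directions to the
    \<open>n\<close> columns, times \<open>2 ^ (n * n)\<close> sets of pairs of columns. Of the
    \<open>n + 3\<close> homogeneous indices one is dropped later; the rest suffice for
    \<open>n\<close> representatives and, as \<open>n + 2 \<ge> 3\<close>, for the argument with
    three families.\<close>
  let ?K = "k ^ n * 2 ^ (n * n)"
  obtain N where "N \<ge> n" and
    ramsey: "\<forall>(C :: ((nat \<Rightarrow> real^2) \<times> (nat \<times> nat) set) set) g.
      finite C \<and> card C = ?K \<and> (\<forall>i j. i < j \<and> j < N \<longrightarrow> g i j \<in> C) \<longrightarrow>
      (\<exists>H\<subseteq>{..<N}. card H = n + 3 \<and> (\<exists>c. \<forall>i\<in>H. \<forall>j\<in>H. i < j \<longrightarrow> g i j = c))"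
    using ramsey_pairs[where 'c = "(nat \<Rightarrow> real^2) \<times> (nat \<times> nat) set" and n = n and M = "n + 3" and K = ?K]
    by (elim exE conjE)
  have "\<exists>R. is_SDR N F n R"
    if U: "finite U" "card U = k" "\<forall>u\<in>U. direction_vector u"
      and F: "\<forall>i\<in>{1..N}. disjoint_subfamily (segments_in_directions U) n (F i)"
    for U :: "(real^2) set" and F
  proof -
    \<comment> \<open>Families are numbered from 1 and rows from 0, so row \<open>i\<close> lists
      \<open>F (Suc i)\<close>.\<close>
    have "\<exists>b. bij_betw b {..<n} (F (Suc i))" if "i < N" for i
      using F that ex_bij_betw_nat_finite[of "F (Suc i)"]
      by (auto simp: disjoint_subfamily_def atLeast0LessThan)
    then obtain a where a: "\<And>i. i < N \<Longrightarrow> bij_betw (a i) {..<n} (F (Suc i))"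
      by metis
    have aF: "a i p \<in> F (Suc i)" if "i < N" "p < n" for i p
      using a[OF \<open>i < N\<close>] that by (auto simp: bij_betw_def)
    have seg: "a i p \<in> segments_in_directions U" if "i < N" "p < n" for i p
      using aF[OF that] F that by (auto simp: disjoint_subfamily_def)
    have row: "a i p \<inter> a i q = {}" if "i < N" "p < n" "q < n" "p \<noteq> q" for i p q
    proof -
      have "pairwise disjnt (F (Suc i))"
        using F that by (auto simp: disjoint_subfamily_def)
      moreover have "a i p \<noteq> a i q"
        using a[OF \<open>i < N\<close>] that by (auto simp: bij_betw_def inj_on_def)
      ultimately show ?thesis
        using aF that by (auto simp: pairwise_def disjnt_def)
    qed
    have "\<exists>u\<in>U. in_direction (a i p) u" if "i < N" "p < n" for i p
      using segments_in_directionsD(3) seg that by blast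
    then obtain d where d: "\<And>i p. i < N \<Longrightarrow> p < n \<Longrightarrow> d i p \<in> U \<and> in_direction (a i p) (d i p)"
      by metis
    define E where "E i j = {(p, q) \<in> {..<n} \<times> {..<n}. a i p \<inter> a j q \<noteq> {}}" for i j
    \<comment> \<open>The colour records the directions in row \<open>i\<close> only. The
      restriction to \<open>{..<n}\<close> makes the direction maps a finite set of known
      size.\<close>
    define g where "g i j = (restrict (d i) {..<n}, E i j)" for i j
    define C where "C = ({..<n} \<rightarrow>\<^sub>E U) \<times> Pow ({..<n} \<times> {..<n})"
    have "finite C" "card C = ?K"
      using U by (auto simp: C_def finite_PiE card_cartesian_product card_PiE card_Pow)
    moreover have "g i j \<in> C" if "i < j" "j < N" for i j
      using that d by (auto simp: g_def C_def E_def)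
    ultimately have "\<exists>H\<subseteq>{..<N}. card H = n + 3 \<and> (\<exists>c. \<forall>i\<in>H. \<forall>j\<in>H. i < j \<longrightarrow> g i j = c)"
      using ramsey[rule_format, of C g] by blast
    then obtain H c where H: "H \<subseteq> {..<N}" "card H = n + 3"
      and "\<forall>i\<in>H. \<forall>j\<in>H. i < j \<longrightarrow> g i j = c"
      by (elim exE conjE)
    then have c: "\<And>i j. i \<in> H \<Longrightarrow> j \<in> H \<Longrightarrow> i < j \<Longrightarrow> g i j = c"
      by simp
    have "finite H"
      using H(1) finite_subset by blast
    have "Max H \<in> H"
      using \<open>finite H\<close> H(2) by (metis Max_in card.empty add_is_0 zero_neq_numeral)
    \<comment> \<open>Every index other than \<open>Max H\<close> is the smaller one of a pair in
      \<open>H\<close>, so its directions are visible in the common colour.\<close>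
    define J where "J = H - {Max H}"
    have J: "J \<subseteq> H" "finite J" "card J = n + 2" "J \<subseteq> {..<N}"
      using \<open>finite H\<close> \<open>Max H \<in> H\<close> H by (auto simp: J_def)
    have less_Max: "i < Max H" if "i \<in> J" for i
      using that \<open>finite H\<close> by (simp add: J_def order_less_le)
    obtain u D where uD: "c = (u, D)"
      by (cases c)
    have du: "d i p = u p" if "i \<in> J" "p < n" for i p
    proof -
      have "restrict (d i) {..<n} = u"
        using c[of i "Max H"] less_Max \<open>Max H \<in> H\<close> J(1) that uD by (auto simp: g_def)
      then show ?thesis
        using that(2) by force
    qed
    have meets_iff: "a i p \<inter> a j q \<noteq> {} \<longleftrightarrow> (p, q) \<in> D"
      if "i \<in> J" "j \<in> J" "i < j" "p < n" "q < n" for i j p q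
    proof -
      have "E i j = D"
        using c[of i j] that J(1) uD by (auto simp: g_def)
      then show ?thesis
        using that by (auto simp: E_def)
    qed
    have ne: "a i p \<noteq> {}" if "i < N" "p < n" for i p
      using segments_in_directionsD(2) seg that by blast
    show ?thesis
    proof (cases "\<exists>p<n. (p, p) \<notin> D")
      case True
      then obtain p where p: "p < n" "(p, p) \<notin> D"
        by blast
      have disj: "a i p \<inter> a j p = {}" if "i \<in> J" "j \<in> J" "i \<noteq> j" for i j
        using meets_iff[of i j p p] meets_iff[of j i p p] p that
        by (metis Int_commute linorder_neqE_nat)
      obtain T where T: "T \<subseteq> J" "card T = n" "finite T"
        using obtain_subset_with_card_n[of n J] J(3) by auto
      have "is_SDR N F n ((\<lambda>i. a i p) ` T)"
      proof (rule is_SDR_image[where r = Suc])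
        show "Suc ` T \<subseteq> {1..N}"
          using T J by force
        show "a i p \<in> F (Suc i)" "a i p \<noteq> {}" if "i \<in> T" for i
          using that T J p aF ne by blast+
        show "a i p \<inter> a j p = {}" if "i \<in> T" "j \<in> T" "i \<noteq> j" for i j
          using that T disj by blast
      qed (use T in auto)
      then show ?thesis by blast
    next
      case False
      then have D: "(p, p) \<in> D" if "p < n" for p
        using that by blast
      have col: "a i p \<inter> a j p \<noteq> {}" if "i \<in> J" "j \<in> J" "i \<noteq> j" "p < n" for i j p
        using meets_iff[of i j p p] meets_iff[of j i p p] D that
        by (metis Int_commute linorder_neqE_nat)
      have "J \<noteq> {}"
        using J(3) by auto
      then obtain i0 where i0: "i0 \<in> J"
        by blast
      have "\<exists>w. a i p \<subseteq> line_in_direction (u p) w" if "i \<in> J" "p < n" for i p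
        using d[of i p] du that J by (auto simp: in_direction_def)
      then obtain w where w: "\<And>i p. i \<in> J \<Longrightarrow> p < n \<Longrightarrow> a i p \<subseteq> line_in_direction (u p) (w i p)"
        by metis
      \<comment> \<open>Row \<open>i0\<close> serves as reference: the member of column
        \<open>p\<close> in any other row is parallel to the one in row \<open>i0\<close> and meets
        it.\<close>
      have line: "a i p \<subseteq> line_in_direction (u p) (w i0 p)" if ip: "i \<in> J" "p < n" for i p
      proof (cases "i = i0")
        case True
        then show ?thesis using w ip by blast
      next
        case False
        then obtain x where "x \<in> a i p" "x \<in> a i0 p"
          using col[of i i0 p] i0 ip by blast
        then have "line_in_direction (u p) (w i p) = line_in_direction (u p) (w i0 p)"
          using w i0 ip line_in_direction_through by (metis subsetD)
        then show ?thesis using w ip by metis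
      qed
      have D_imp_eq: "line_in_direction (u p) (w i0 p) = line_in_direction (u q) (w i0 q)"
        if pq: "(p, q) \<in> D" "p < n" "q < n" for p q
      proof (rule ccontr)
        assume neq: "\<not> ?thesis"
        obtain T where T: "T \<subseteq> J" "card T = 3"
          using obtain_subset_with_card_n[of 3 J] J(3) assms(1) by auto
        then have "T \<in> nsets J 3"
          using J(2) finite_subset by (auto simp: nsets_def)
        then obtain x y z where xyz: "x \<in> J" "y \<in> J" "z \<in> J" "x < y" "y < z"
          by (auto simp: ordered_nsets_3_eq)
        \<comment> \<open>The same pair \<open>(p, q)\<close> is used for the rows
          \<open>x < y\<close> and \<open>y < z\<close>. Both points lie on both lines, so they
          coincide, and row \<open>y\<close> has a common point of its columns \<open>p\<close> and
          \<open>q\<close>.\<close>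
        obtain s t where s: "s \<in> a x p" "s \<in> a y q" and t: "t \<in> a y p" "t \<in> a z q"
          using meets_iff[of x y p q] meets_iff[of y z p q] xyz pq by blast
        have "s \<in> line_in_direction (u p) (w i0 p)" "t \<in> line_in_direction (u p) (w i0 p)"
          "s \<in> line_in_direction (u q) (w i0 q)" "t \<in> line_in_direction (u q) (w i0 q)"
          using line xyz pq s t by blast+
        then have "s = t"
          using neq line_in_direction_two_points[of s _ _ t] by metis
        then have "a y p \<inter> a y q \<noteq> {}"
          using s t by blast
        moreover have "p \<noteq> q"
          using neq by blast
        ultimately show False
          using row[of y p q] xyz pq J by blast
      qed
      have "\<exists>\<sigma>. inj_on \<sigma> {..<n} \<and> \<sigma> ` {..<n} \<subseteq> J \<and>
        (\<forall>p\<in>{..<n}. \<forall>q\<in>{..<n}. p \<noteq> q \<longrightarrow> a (\<sigma> p) p \<inter> a (\<sigma> q) q = {})"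
      proof (rule disjoint_choice_collinear_columns[where u = u and v = "w i0"])
        show "connected (a i p)" if "i \<in> J" "p \<in> {..<n}" for i p
          using that J seg segments_in_directionsD(1) by blast
        show "u p \<noteq> 0" if "p \<in> {..<n}" for p
          using d[of i0 p] du[of i0 p] i0 J that U(3) by (auto simp: direction_vector_def)
        show "a i p \<inter> a j q = {}"
          if "i \<in> J" "j \<in> J" "i \<noteq> j" "p \<in> {..<n}" "q \<in> {..<n}"
            "line_in_direction (u p) (w i0 p) \<noteq> line_in_direction (u q) (w i0 q)" for i j p q
        proof -
          \<comment> \<open>\<open>D\<close> need not be symmetric: its first entry refers to the
            smaller row index, so both orders of \<open>i\<close> and \<open>j\<close> have to be
            covered.\<close>
          have "(p, q) \<notin> D" "(q, p) \<notin> D"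
            using D_imp_eq[of p q] D_imp_eq[of q p] that by auto
          then show ?thesis
            using meets_iff[of i j p q] meets_iff[of j i q p] that
            by (metis Int_commute lessThan_iff linorder_neqE_nat)
        qed
        show "a i p \<inter> a i q = {}" if "i \<in> J" "p \<in> {..<n}" "q \<in> {..<n}" "p \<noteq> q" for i p q
          using that row J by blast
      qed (use J line col in auto)
      then obtain \<sigma> where \<sigma>: "inj_on \<sigma> {..<n}" "\<sigma> ` {..<n} \<subseteq> J"
        "\<forall>p\<in>{..<n}. \<forall>q\<in>{..<n}. p \<noteq> q \<longrightarrow> a (\<sigma> p) p \<inter> a (\<sigma> q) q = {}"
        by blast
      have "is_SDR N F n ((\<lambda>p. a (\<sigma> p) p) ` {..<n})"
      proof (rule is_SDR_image[where r = "\<lambda>p. Suc (\<sigma> p)" and b = "\<lambda>p. a (\<sigma> p) p"])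
        show "inj_on (\<lambda>p. Suc (\<sigma> p)) {..<n}"
          using \<sigma>(1) by (auto simp: inj_on_def)
        show "(\<lambda>p. Suc (\<sigma> p)) ` {..<n} \<subseteq> {1..N}"
          using \<sigma>(2) J(4) by force
        show "a (\<sigma> p) p \<in> F (Suc (\<sigma> p))" "a (\<sigma> p) p \<noteq> {}" if "p \<in> {..<n}" for p
          using that \<sigma>(2) J(4) aF[of "\<sigma> p" p] ne[of "\<sigma> p" p] by blast+
      qed (use \<sigma>(3) in auto)
      then show ?thesis by blast
    qed
  qed
  \<comment> \<open>\<open>N\<close> belongs to the set whose infimum is
    \<open>sdr_number\<close>.\<close>
  then have "sdr_number (segments_in_directions U) n \<le> enat N"
    if "finite U" "card U = k" "\<forall>u\<in>U. direction_vector u" for U :: "(real^2) set"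
    unfolding sdr_number_def using that \<open>N \<ge> n\<close> by (intro Inf_lower) blast
  then show ?thesis
    using \<open>N \<ge> n\<close> assms(1) by (intro exI[of _ N]) auto
qed

end
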